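(* Let $\Omega\subset\mathbb{R}^2$ be a bounded domain and let the diffusion matrix $\mathbb{D}=\begin{bmatrix} a & b\\ b& c\end{bmatrix}$ be continuous on $\overline{\Omega}$ and symmetric and uniformly positive definite on $\Omega$. Then there exists a constant $R>0$ (depending only on $\mathbb{D}$, and not on $(x_0,y_0)$) such that for every $(x_0,y_0)\in\Omega$ the following holds. The open interval $$\left(\sup_{B_R^+(x_0,y_0)}\frac{b(x,y)}{a(x,y)},\ \inf_{B_R^+(x_0,y_0)}\frac{c(x,y)}{b(x,y)}\right)$$ is nonempty whenever $B_R^+(x_0,y_0)\neq\emptyset$, and the open interval $$\left(\sup_{B_R^-(x_0,y_0)}\frac{c(x,y)}{b(x,y)},\ \inf_{B_R^-(x_0,y_0)}\frac{b(x,y)}{a(x,y)}\right)$$ is nonempty whenever $B_R^-(x_0,y_0)\neq\emptyset$. Moreover, for any constants $\beta_1,\beta_2$ with $\tan\beta_1$ in the first interval and $\tan\beta_2$ in the second interval, the functions $\gamma_0,\gamma_1^+,\gamma_1^-,\gamma_2$ defined on $B_R(x_0,y_0)$ by $$\gamma_0=\begin{cases} a-b\cot\beta_1, & b\ge 0\\ a-b\cot\beta_2, & b<0\end{cases}\qquad \gamma_1^+=\begin{cases}\dfrac{b}{\cos\beta_1\sin\beta_1}, & b\ge 0\\ 0, & b<0\end{cases}$$ $$\gamma_1^-=\begin{cases}0, & b\ge 0\\ \dfrac{b}{\cos\beta_2\sin\beta_2}, & b<0\end{cases}\qquad \gamma_2=\begin{cases} c-b\tan\beta_1, & b\ge 0\\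 c-b\tan\beta_2, & b<0\end{cases}$$ (all functions and conditions evaluated at $(x,y)$) are all nonnegative on $B_R(x_0,y_0)$, and the directional splitting $$\nabla\cdot(\mathbb{D}\nabla u)(x_0,y_0)=\partial_x(\gamma_0\,\partial_x u)(x_0,y_0)+\partial_{\beta_1}(\gamma_1^+\,\partial_{\beta_1}u)(x_0,y_0)+\partial_{\beta_2}(\gamma_1^-\,\partial_{\beta_2}u)(x_0,y_0)+\partial_y(\gamma_2\,\partial_y u)(x_0,y_0)$$ holds.
   Context: Here $a,b,c$ are real functions of $(x,y)$; uniformly positive definite on $\Omega$ means there is $\lambda>0$ with $\xi^T\mathbb{D}(x,y)\xi\ge\lambda|\xi|^2$ for all $\xi\in\mathbb{R}^2$, $(x,y)\in\Omega$. Notation: $B_R(x_0,y_0)=\{(x,y)\in\Omega: |(x,y)-(x_0,y_0)|<R\}$; $B_R^+(x_0,y_0)$ and $B_R^-(x_0,y_0)$ are the subsets of $B_R(x_0,y_0)$ on which $b>0$ and $b<0$, respectively. For an angle $\beta$, $\partial_\beta=\cos\beta\,\partial_x+\sin\beta\,\partial_y$ is the directional derivative in the direction $(\cos\beta,\sin\beta)$. Convention on empty sets: formulas involving an empty set are ignored. Thus if $B_R^+(x_0,y_0)=\emptyset$ (resp. $B_R^-(x_0,y_0)=\emptyset$), no condition is imposed on $\beta_1$ (resp. $\beta_2$) other than $\sin\beta_i\cos\beta_i\ne 0$. Interpretation of the splitting identity: it is asserted for every function $u$ that is $C^1$ near $(x_0,y_0)$ and for which the functions $\gamma_0\partial_x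 u$, $\gamma_1^+\partial_{\beta_1}u$, $\gamma_1^-\partial_{\beta_2}u$, $\gamma_2\partial_y u$ are differentiable at $(x_0,y_0)$. *)

theory Defs
  imports "HOL-Analysis.Analysis"
begin

text \<open>A point \<open>(x, y)\<close> of the plane is \<open>p :: real^2\<close> with \<open>x = p $ 1\<close> and \<open>y = p $ 2\<close>.
  Functions on a subset of the plane are total functions; only their values on that subset
  (or near the point at which derivatives are taken) matter.\<close>

definition uniformly_positive_definite_on :: "(real^2) set \<Rightarrow> (real^2 \<Rightarrow> real^2^2) \<Rightarrow> bool" where
  "uniformly_positive_definite_on \<Omega> D \<longleftrightarrow>
     (\<exists>m>0. \<forall>p\<in>\<Omega>. \<forall>\<xi>. \<xi> \<bullet> (D p *v \<xi>) \<ge> m * (norm \<xi>)\<^sup>2)"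


definition rel_ball :: "(real^2) set \<Rightarrow> real \<Rightarrow> real^2 \<Rightarrow> (real^2) set" where
  "rel_ball \<Omega> R p0 = {p \<in> \<Omega>. norm (p - p0) < R}"

definition rel_ball_pos :: "(real^2) set \<Rightarrow> (real^2 \<Rightarrow> real) \<Rightarrow> real \<Rightarrow> real^2 \<Rightarrow> (real^2) set" where
  "rel_ball_pos \<Omega> b R p0 = {p \<in> rel_ball \<Omega> R p0. b p > 0}"

definition rel_ball_neg :: "(real^2) set \<Rightarrow> (real^2 \<Rightarrow> real) \<Rightarrow> real \<Rightarrow> real^2 \<Rightarrow> (real^2) set" where
  "rel_ball_neg \<Omega> b R p0 = {p \<in> rel_ball \<Omega> R p0. b p < 0}"


text \<open>The suprema and infima below are taken in the reals. They are used only for nonempty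
  \<open>S\<close>, on which \<open>b > 0\<close> (resp. \<open>b < 0\<close>), and for \<open>a\<close>, \<open>b\<close> bounded with \<open>a\<close> bounded away
  from zero and \<open>c > 0\<close>; the sets are then bounded on the relevant side, so they are the
  genuine suprema and infima.\<close>

definition slopes_pos ::
    "(real^2 \<Rightarrow> real) \<Rightarrow> (real^2 \<Rightarrow> real) \<Rightarrow> (real^2 \<Rightarrow> real) \<Rightarrow> (real^2) set \<Rightarrow> real set" where
  "slopes_pos a b c S = {(SUP p\<in>S. b p / a p) <..< (INF p\<in>S. c p / b p)}"

definition slopes_neg ::
    "(real^2 \<Rightarrow> real) \<Rightarrow> (real^2 \<Rightarrow> real) \<Rightarrow> (real^2 \<Rightarrow> real) \<Rightarrow> (real^2) set \<Rightarrow> real set" where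
  "slopes_neg a b c S = {(SUP p\<in>S. c p / b p) <..< (INF p\<in>S. b p / a p)}"


definition gamma0 ::
    "(real^2 \<Rightarrow> real) \<Rightarrow> (real^2 \<Rightarrow> real) \<Rightarrow> real \<Rightarrow> real \<Rightarrow> real^2 \<Rightarrow> real" where
  "gamma0 a b \<beta>1 \<beta>2 p = (if b p \<ge> 0 then a p - b p * cot \<beta>1 else a p - b p * cot \<beta>2)"

definition gamma1_pos :: "(real^2 \<Rightarrow> real) \<Rightarrow> real \<Rightarrow> real^2 \<Rightarrow> real" where
  "gamma1_pos b \<beta>1 p = (if b p \<ge> 0 then b p / (cos \<beta>1 * sin \<beta>1) else 0)"

definition gamma1_neg :: "(real^2 \<Rightarrow> real) \<Rightarrow> real \<Rightarrow> real^2 \<Rightarrow> real" where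
  "gamma1_neg b \<beta>2 p = (if b p \<ge> 0 then 0 else b p / (cos \<beta>2 * sin \<beta>2))"

definition gamma2 ::
    "(real^2 \<Rightarrow> real) \<Rightarrow> (real^2 \<Rightarrow> real) \<Rightarrow> real \<Rightarrow> real \<Rightarrow> real^2 \<Rightarrow> real" where
  "gamma2 b c \<beta>1 \<beta>2 p = (if b p \<ge> 0 then c p - b p * tan \<beta>1 else c p - b p * tan \<beta>2)"


definition dir_deriv :: "real^2 \<Rightarrow> (real^2 \<Rightarrow> real) \<Rightarrow> real^2 \<Rightarrow> real" where
  "dir_deriv v f p = deriv (\<lambda>t. f (p + t *\<^sub>R v)) 0"

definition partial_x :: "(real^2 \<Rightarrow> real) \<Rightarrow> real^2 \<Rightarrow> real" where
  "partial_x f p = dir_deriv (vector [1, 0]) f p"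

definition partial_y :: "(real^2 \<Rightarrow> real) \<Rightarrow> real^2 \<Rightarrow> real" where
  "partial_y f p = dir_deriv (vector [0, 1]) f p"

text \<open>\<open>\<partial>\<^sub>\<beta> = cos \<beta> \<partial>\<^sub>x + sin \<beta> \<partial>\<^sub>y\<close>, as a derivative along the unit vector at angle \<open>\<beta>\<close>.\<close>

definition partial_angle :: "real \<Rightarrow> (real^2 \<Rightarrow> real) \<Rightarrow> real^2 \<Rightarrow> real" where
  "partial_angle \<beta> f p = dir_deriv (vector [cos \<beta>, sin \<beta>]) f p"

definition gradient :: "(real^2 \<Rightarrow> real) \<Rightarrow> real^2 \<Rightarrow> real^2" where
  "gradient u p = vector [partial_x u p, partial_y u p]"

definition divergence :: "(real^2 \<Rightarrow> real^2) \<Rightarrow> real^2 \<Rightarrow> real" where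
  "divergence F p = partial_x (\<lambda>q. F q $ 1) p + partial_y (\<lambda>q. F q $ 2) p"

definition C1_near :: "(real^2 \<Rightarrow> real) \<Rightarrow> real^2 \<Rightarrow> bool" where
  "C1_near u p0 \<longleftrightarrow>
     (\<exists>U. \<exists>u' :: real^2 \<Rightarrow> ((real^2) \<Rightarrow>\<^sub>L real).
        open U \<and> p0 \<in> U \<and> continuous_on U u' \<and>
        (\<forall>p\<in>U. (u has_derivative blinfun_apply (u' p)) (at p)))"

end

theory Submission
  imports Defs
begin

text \<open>Testing the quadratic form with \<open>(1, 0)\<close>, \<open>(0, 1)\<close> and \<open>(- b, a)\<close> turns uniform
  positive definiteness with constant \<open>m\<close> into \<open>a \<ge> m\<close>, \<open>c \<ge> m\<close> and \<open>a c - b\<^sup>2 \<ge> m a\<close>.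
  Since \<open>c / b - b / a = (a c - b\<^sup>2) / (a b)\<close>, the two slopes \<open>b / a\<close> and \<open>c / b\<close> at one point
  differ by at least \<open>m / M\<close>, where \<open>M\<close> bounds \<open>\<bar>b\<bar>\<close>, and \<open>c / b\<close> is the one farther
  from zero. The slope \<open>b / a\<close> extends continuously to the compact closure of the domain, so it is
  uniformly continuous there; on every ball of a fixed small radius it varies by less than half of
  \<open>m / M\<close>. The slope \<open>c / b\<close> may be unbounded where \<open>b\<close> approaches zero; the
  pointwise gap moves the estimate from \<open>b / a\<close> to it. Hence the two ranges of
  slopes over the ball stay apart by at least \<open>m / (2 M)\<close>.

  A slope \<open>t\<close> strictly between \<open>b / a\<close> and \<open>c / b\<close> has the sign of \<open>b\<close> and satisfies
  \<open>b / t \<le> a\<close> and \<open>b t \<le> c\<close>, which gives the nonnegativity of the four coefficients.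

  The splitting identity is already true for the flux. With \<open>e(\<beta>) = (cos \<beta>, sin \<beta>)\<close>,
  near the centre the field \<open>D \<nabla>u\<close> equals
  \<open>G\<^sub>0 (1, 0) + G\<^sub>1 e(\<beta>\<^sub>1) + G\<^sub>2 e(\<beta>\<^sub>2) + G\<^sub>3 (0, 1)\<close>, where the \<open>G\<^sub>i\<close> are the four scalar
  functions that are assumed differentiable. The divergence of \<open>G v\<close> for a constant vector \<open>v\<close>
  is the derivative of \<open>G\<close> in direction \<open>v\<close>, and the identity follows by linearity.\<close>

section \<open>Slopes of a positive definite matrix\<close>

lemma positive_definite_entry_bounds:
  fixes a b c m :: real
  assumes pd: "\<And>\<xi> :: real^2. m * (norm \<xi>)\<^sup>2 \<le> \<xi> \<bullet> ((vector [vector [a, b], vector [b, c]] :: real^2^2) *v \<xi>)"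
    and "m > 0"
  shows "m \<le> a" and "m \<le> c" and "m * a \<le> a * c - b\<^sup>2"
proof -
  have form: "m * (x\<^sup>2 + y\<^sup>2) \<le> x * (a * x + b * y) + y * (b * x + c * y)" for x y
    using pd[of "vector [x, y]"] unfolding power2_norm_eq_inner
    by (simp add: inner_vec_def sum_2 matrix_vector_mult_def power2_eq_square)
  show a: "m \<le> a" using form[of 1 0] by simp
  show "m \<le> c" using form[of 0 1] by simp
  have "m * a\<^sup>2 \<le> m * ((- b)\<^sup>2 + a\<^sup>2)" using \<open>m > 0\<close> by simp
  also have "\<dots> \<le> a * (a * c - b\<^sup>2)"
    using form[of "- b" a] by (simp add: algebra_simps power2_eq_square)
  finally have "a * (m * a) \<le> a * (a * c - b\<^sup>2)"
    by (simp add: algebra_simps power2_eq_square)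
  then show "m * a \<le> a * c - b\<^sup>2" using a \<open>m > 0\<close> by simp
qed

lemma slope_gap_pos:
  fixes a b c m M :: real
  assumes "0 < m" "m \<le> a" "0 < b" "b \<le> M" "m * a \<le> a * c - b\<^sup>2"
  shows "b / a + m / M \<le> c / b"
proof -
  have "m / M \<le> m / b" using assms by (intro divide_left_mono) auto
  also have "\<dots> \<le> c / b - b / a"
    using assms by (simp add: field_simps power2_eq_square)
  finally show ?thesis by simp
qed

lemma slope_gap_neg:
  fixes a b c m M :: real
  assumes "0 < m" "m \<le> a" "b < 0" "- b \<le> M" "m * a \<le> a * c - b\<^sup>2"
  shows "c / b + m / M \<le> b / a"
  using slope_gap_pos[of m a "- b" M c] assms by simp

lemma slope_between_pos:
  fixes a b c t :: real
  assumes "0 < a" "0 < b" "b / a < t" "t < c / b"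
  shows "0 < t" "b / t \<le> a" "b * t \<le> c"
proof -
  show t: "0 < t" using assms by (meson divide_pos_pos less_trans)
  show "b / t \<le> a" "b * t \<le> c" using assms t by (simp_all add: field_simps)
qed

lemma slope_between_neg:
  fixes a b c t :: real
  assumes "0 < a" "b < 0" "c / b < t" "t < b / a"
  shows "t < 0" "b / t \<le> a" "b * t \<le> c"
  using slope_between_pos[of a "- b" "- t" c] assms by simp_all

text \<open>Suprema and infima in the reals are the genuine ones only for bounded sets. A uniform gap
  provides the boundedness together with the strict inequality.\<close>

lemma SUP_less_INF_if_gap:
  fixes f g :: "'a \<Rightarrow> real"
  assumes "S \<noteq> {}" "0 < d" and gap: "\<forall>p\<in>S. \<forall>q\<in>S. f p + d \<le> g q"
  shows "(SUP p\<in>S. f p) < (INF p\<in>S. g p)"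
proof -
  have "(SUP p\<in>S. f p) \<le> g q - d" if "q \<in> S" for q
    using assms(1) gap that by (intro cSUP_least) (auto simp: le_diff_eq)
  then have "(SUP p\<in>S. f p) + d \<le> (INF p\<in>S. g p)"
    using assms(1) by (intro cINF_greatest) (auto simp: le_diff_eq)
  with \<open>0 < d\<close> show ?thesis by simp
qed

lemma between_SUP_INF_if_gap:
  fixes f g :: "'a \<Rightarrow> real"
  assumes "p \<in> S" "0 < d" and gap: "\<forall>p\<in>S. \<forall>q\<in>S. f p + d \<le> g q"
    and "t \<in> {(SUP p\<in>S. f p) <..< (INF p\<in>S. g p)}"
  shows "f p < t" "t < g p"
proof -
  have "f q \<le> g p" "f p \<le> g q" if "q \<in> S" for q
    using gap[rule_format, OF that \<open>p \<in> S\<close>]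
      gap[rule_format, OF \<open>p \<in> S\<close> that] \<open>0 < d\<close> by auto
  then have "bdd_above (f ` S)" "bdd_below (g ` S)"
    by (meson bdd_aboveI2 bdd_belowI2)+
  then have "f p \<le> (SUP p\<in>S. f p)" "(INF p\<in>S. g p) \<le> g p"
    using \<open>p \<in> S\<close> by (auto intro: cSUP_upper cINF_lower)
  with assms(4) show "f p < t" "t < g p" by auto
qed

section \<open>Nonnegativity of the coefficients\<close>

lemma cot_eq_inverse_tan: "cot \<beta> = 1 / tan (\<beta> :: real)"
  by (simp add: cot_def tan_def)

lemma cos_mult_sin_eq_tan: "cos \<beta> * sin \<beta> = tan \<beta> * (cos (\<beta> :: real))\<^sup>2"
  by (simp add: tan_def power2_eq_square)

lemma gammas_nonneg:
  assumes "0 < a p" "0 \<le> c p"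
    and pos: "0 < b p \<Longrightarrow> b p / a p < tan \<beta>1 \<and> tan \<beta>1 < c p / b p"
    and neg: "b p < 0 \<Longrightarrow> c p / b p < tan \<beta>2 \<and> tan \<beta>2 < b p / a p"
  shows "0 \<le> gamma0 a b \<beta>1 \<beta>2 p" "0 \<le> gamma1_pos b \<beta>1 p"
    "0 \<le> gamma1_neg b \<beta>2 p" "0 \<le> gamma2 b c \<beta>1 \<beta>2 p"
proof -
  consider "b p = 0" | "0 < b p" | "b p < 0" by linarith
  then have "0 \<le> gamma0 a b \<beta>1 \<beta>2 p \<and> 0 \<le> gamma1_pos b \<beta>1 p
    \<and> 0 \<le> gamma1_neg b \<beta>2 p \<and> 0 \<le> gamma2 b c \<beta>1 \<beta>2 p"
  proof cases
    case 1
    then show ?thesis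
      using assms(1,2) by (simp add: gamma0_def gamma1_pos_def gamma1_neg_def gamma2_def)
  next
    case 2
    with slope_between_pos[of "a p" "b p" "tan \<beta>1" "c p"] pos assms(1)
    show ?thesis
      by (simp add: gamma0_def gamma1_pos_def gamma1_neg_def gamma2_def
          cot_eq_inverse_tan cos_mult_sin_eq_tan)
  next
    case 3
    with slope_between_neg[of "a p" "b p" "c p" "tan \<beta>2"] neg assms(1)
    have "tan \<beta>2 < 0" "b p / tan \<beta>2 \<le> a p" "b p * tan \<beta>2 \<le> c p" by auto
    moreover from this have "tan \<beta>2 * (cos \<beta>2)\<^sup>2 \<le> 0" by (simp add: mult_nonpos_nonneg)
    ultimately show ?thesis
      using 3 by (simp add: gamma0_def gamma1_pos_def gamma1_neg_def gamma2_def
          cot_eq_inverse_tan cos_mult_sin_eq_tan divide_nonpos_nonpos)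
  qed
  then show "0 \<le> gamma0 a b \<beta>1 \<beta>2 p" "0 \<le> gamma1_pos b \<beta>1 p"
    "0 \<le> gamma1_neg b \<beta>2 p" "0 \<le> gamma2 b c \<beta>1 \<beta>2 p" by auto
qed

section \<open>Splitting the flux\<close>

lemma dir_deriv_eq:
  assumes "(f has_derivative f') (at p)"
  shows "dir_deriv v f p = f' v"
proof -
  interpret bounded_linear f' using assms by (rule has_derivative_bounded_linear)
  have "((\<lambda>t. p + t *\<^sub>R v) has_derivative (\<lambda>t. t *\<^sub>R v)) (at 0)"
    by (auto intro!: derivative_eq_intros)
  moreover have "(f has_derivative f') (at (p + 0 *\<^sub>R v))" using assms by simp
  ultimately have "((\<lambda>t. f (p + t *\<^sub>R v)) has_derivative (\<lambda>t. f' (t *\<^sub>R v))) (at 0)"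
    by (rule has_derivative_compose)
  then have "((\<lambda>t. f (p + t *\<^sub>R v)) has_field_derivative f' v) (at 0)"
    by (simp add: has_field_derivative_def scaleR mult_commute_abs)
  then show ?thesis unfolding dir_deriv_def by (rule DERIV_imp_deriv)
qed

lemma linear_eq_axes:
  fixes L :: "real^2 \<Rightarrow> real"
  assumes "linear L"
  shows "L w = w $ 1 * L (vector [1, 0]) + w $ 2 * L (vector [0, 1])"
proof -
  have "w = (w $ 1) *\<^sub>R vector [1, 0] + (w $ 2) *\<^sub>R vector [0, 1]"
    by (simp add: vec_eq_iff forall_2)
  then have "L w = L ((w $ 1) *\<^sub>R vector [1, 0] + (w $ 2) *\<^sub>R vector [0, 1])"
    by (rule arg_cong)
  also have "\<dots> = w $ 1 * L (vector [1, 0]) + w $ 2 * L (vector [0, 1])"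
    by (simp add: linear_add[OF assms] linear_scale[OF assms])
  finally show ?thesis .
qed

lemma partial_angle_eq:
  assumes "u differentiable (at p)"
  shows "partial_angle \<beta> u p = cos \<beta> * partial_x u p + sin \<beta> * partial_y u p"
proof -
  obtain u' where u': "(u has_derivative u') (at p)"
    using assms unfolding differentiable_def by blast
  have "linear u'" using u' by (rule has_derivative_linear)
  from linear_eq_axes[OF this, of "vector [cos \<beta>, sin \<beta>]"] show ?thesis
    by (simp add: partial_angle_def partial_x_def partial_y_def dir_deriv_eq[OF u'])
qed

text \<open>The angle \<open>\<beta>\<close> is the one selected by the sign of \<open>b\<close>: for the other angle the
  coefficient vanishes, so only one mixed direction is active at each point.\<close>

lemma flux_component_identities:
  fixes a b c ux uy :: real
  assumes "sin \<beta> * cos \<beta> \<noteq> 0"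
  defines "g \<equiv> b / (cos \<beta> * sin \<beta>) * (cos \<beta> * ux + sin \<beta> * uy)"
  shows "(a - b * cot \<beta>) * ux + cos \<beta> * g = a * ux + b * uy"
    and "sin \<beta> * g + (c - b * tan \<beta>) * uy = b * ux + c * uy"
  using assms(1) unfolding g_def cot_def tan_def by (auto simp: field_simps)

lemma flux_split:
  fixes D :: "real^2 \<Rightarrow> real^2^2"
  assumes "sin \<beta>1 * cos \<beta>1 \<noteq> 0" "sin \<beta>2 * cos \<beta>2 \<noteq> 0"
    and "u differentiable (at p)"
    and D: "D p = vector [vector [a p, b p], vector [b p, c p]]"
  shows "D p *v gradient u p =
      (gamma0 a b \<beta>1 \<beta>2 p * partial_x u p) *\<^sub>R vector [1, 0]
    + (gamma1_pos b \<beta>1 p * partial_angle \<beta>1 u p) *\<^sub>R vector [cos \<beta>1, sin \<beta>1]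
    + (gamma1_neg b \<beta>2 p * partial_angle \<beta>2 u p) *\<^sub>R vector [cos \<beta>2, sin \<beta>2]
    + (gamma2 b c \<beta>1 \<beta>2 p * partial_y u p) *\<^sub>R vector [0, 1]"
proof (cases "0 \<le> b p")
  case True
  then show ?thesis
    using assms(1) flux_component_identities[OF assms(1),
        where b = "b p" and ux = "partial_x u p" and uy = "partial_y u p"]
    unfolding vec_eq_iff forall_2
    by (simp add: D matrix_vector_mult_def sum_2 gradient_def
        partial_angle_eq[OF assms(3)] gamma0_def gamma1_pos_def gamma1_neg_def gamma2_def mult.commute)
next
  case False
  then show ?thesis
    using assms(2) flux_component_identities[OF assms(2),
        where b = "b p" and ux = "partial_x u p" and uy = "partial_y u p"]
    unfolding vec_eq_iff forall_2
    by (simp add: D matrix_vector_mult_def sum_2 gradient_def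
        partial_angle_eq[OF assms(3)] gamma0_def gamma1_pos_def gamma1_neg_def gamma2_def mult.commute)
qed

text \<open>For a single term \<open>G v\<close> with \<open>v\<close> constant, the divergence is
  \<open>\<partial>\<^sub>x G v\<^sub>1 + \<partial>\<^sub>y G v\<^sub>2\<close>, which is the derivative of \<open>G\<close> in direction \<open>v\<close>.\<close>

lemma divergence_of_directional_sum:
  fixes F :: "real^2 \<Rightarrow> real^2" and G :: "'i \<Rightarrow> real^2 \<Rightarrow> real" and v :: "'i \<Rightarrow> real^2"
  assumes G: "\<And>i. i \<in> I \<Longrightarrow> G i differentiable (at p)"
    and eq: "\<forall>\<^sub>F q in nhds p. F q = (\<Sum>i\<in>I. G i q *\<^sub>R v i)"
  shows "F differentiable (at p)" "divergence F p = (\<Sum>i\<in>I. dir_deriv (v i) (G i) p)"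
proof -
  define G' where "G' i = frechet_derivative (G i) (at p)" for i
  have G': "(G i has_derivative G' i) (at p)" if "i \<in> I" for i
    using G[OF that] unfolding G'_def by (simp add: frechet_derivative_works)
  have "((\<lambda>q. \<Sum>i\<in>I. G i q *\<^sub>R v i) has_derivative (\<lambda>h. \<Sum>i\<in>I. G' i h *\<^sub>R v i)) (at p)"
    by (intro has_derivative_sum has_derivative_scaleR_left G')
  then have F': "(F has_derivative (\<lambda>h. \<Sum>i\<in>I. G' i h *\<^sub>R v i)) (at p)"
    using has_derivative_transform_eventually[of _ _ p UNIV F] eq eventually_nhds_x_imp_x[OF eq]
    by (simp add: eventually_at_filter eventually_mono)
  then show "F differentiable (at p)" by (rule differentiableI)
  have comp: "((\<lambda>q. F q $ k) has_derivative (\<lambda>h. (\<Sum>i\<in>I. G' i h *\<^sub>R v i) $ k)) (at p)" for k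
    using F' by (rule bounded_linear.has_derivative[OF bounded_linear_vec_nth])
  have "divergence F p
      = (\<Sum>i\<in>I. G' i (vector [1, 0]) * v i $ 1 + G' i (vector [0, 1]) * v i $ 2)"
    unfolding divergence_def partial_x_def partial_y_def dir_deriv_eq[OF comp]
    by (simp add: sum.distrib)
  also have "\<dots> = (\<Sum>i\<in>I. dir_deriv (v i) (G i) p)"
  proof (rule sum.cong[OF refl])
    fix i assume "i \<in> I"
    have "linear (G' i)" using G'[OF \<open>i \<in> I\<close>] by (rule has_derivative_linear)
    from linear_eq_axes[OF this, of "v i"]
    show "G' i (vector [1, 0]) * v i $ 1 + G' i (vector [0, 1]) * v i $ 2
        = dir_deriv (v i) (G i) p"
      by (simp add: dir_deriv_eq[OF G'[OF \<open>i \<in> I\<close>]] mult.commute)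
  qed
  finally show "divergence F p = (\<Sum>i\<in>I. dir_deriv (v i) (G i) p)" .
qed

lemma divergence_splitting:
  fixes D :: "real^2 \<Rightarrow> real^2^2"
  assumes angles: "sin \<beta>1 * cos \<beta>1 \<noteq> 0" "sin \<beta>2 * cos \<beta>2 \<noteq> 0"
    and u: "\<forall>\<^sub>F p in nhds p0. u differentiable (at p)"
    and D: "\<forall>\<^sub>F p in nhds p0. D p = vector [vector [a p, b p], vector [b p, c p]]"
    and diff: "(\<lambda>p. gamma0 a b \<beta>1 \<beta>2 p * partial_x u p) differentiable (at p0)"
      "(\<lambda>p. gamma1_pos b \<beta>1 p * partial_angle \<beta>1 u p) differentiable (at p0)"
      "(\<lambda>p. gamma1_neg b \<beta>2 p * partial_angle \<beta>2 u p) differentiable (at p0)"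
      "(\<lambda>p. gamma2 b c \<beta>1 \<beta>2 p * partial_y u p) differentiable (at p0)"
  shows "(\<lambda>p. D p *v gradient u p) differentiable (at p0)"
    and "divergence (\<lambda>p. D p *v gradient u p) p0 =
             partial_x (\<lambda>p. gamma0 a b \<beta>1 \<beta>2 p * partial_x u p) p0
             + partial_angle \<beta>1 (\<lambda>p. gamma1_pos b \<beta>1 p * partial_angle \<beta>1 u p) p0
             + partial_angle \<beta>2 (\<lambda>p. gamma1_neg b \<beta>2 p * partial_angle \<beta>2 u p) p0
             + partial_y (\<lambda>p. gamma2 b c \<beta>1 \<beta>2 p * partial_y u p) p0"
proof -
  let ?G = "\<lambda>i. [\<lambda>p. gamma0 a b \<beta>1 \<beta>2 p * partial_x u p,
      \<lambda>p. gamma1_pos b \<beta>1 p * partial_angle \<beta>1 u p,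
      \<lambda>p. gamma1_neg b \<beta>2 p * partial_angle \<beta>2 u p,
      \<lambda>p. gamma2 b c \<beta>1 \<beta>2 p * partial_y u p] ! i"
  let ?v = "\<lambda>i. [vector [1, 0], vector [cos \<beta>1, sin \<beta>1], vector [cos \<beta>2, sin \<beta>2],
      vector [0, 1] :: real^2] ! i"
  have four: "{..<4::nat} = {0, 1, 2, 3}" by auto
  have G: "?G i differentiable (at p0)" if "i \<in> {..<4}" for i
    using that diff unfolding four by auto
  have "\<forall>\<^sub>F p in nhds p0. D p *v gradient u p = (\<Sum>i<4. ?G i p *\<^sub>R ?v i)"
    using u D
    by eventually_elim (subst flux_split[OF angles], assumption+, simp add: four add.assoc)
  note split = divergence_of_directional_sum[OF G this]
  show "(\<lambda>p. D p *v gradient u p) differentiable (at p0)" by (rule split(1))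
  show "divergence (\<lambda>p. D p *v gradient u p) p0 =
             partial_x (\<lambda>p. gamma0 a b \<beta>1 \<beta>2 p * partial_x u p) p0
             + partial_angle \<beta>1 (\<lambda>p. gamma1_pos b \<beta>1 p * partial_angle \<beta>1 u p) p0
             + partial_angle \<beta>2 (\<lambda>p. gamma1_neg b \<beta>2 p * partial_angle \<beta>2 u p) p0
             + partial_y (\<lambda>p. gamma2 b c \<beta>1 \<beta>2 p * partial_y u p) p0"
    using split(2)
    by (simp add: four add.assoc partial_x_def partial_y_def partial_angle_def)
qed

section \<open>A uniform radius\<close>

text \<open>The bounds are required on the closure because uniform continuity of \<open>b / a\<close> comes from
  its compactness; the radius is half the modulus of continuity because two points of a ball may
  be twice the radius apart.\<close>

lemma uniform_slope_gap:
  fixes a b c :: "real^2 \<Rightarrow> real"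
  assumes "bounded \<Omega>" and cont: "continuous_on (closure \<Omega>) a" "continuous_on (closure \<Omega>) b"
    and m: "0 < m" "\<And>p. p \<in> closure \<Omega> \<Longrightarrow> m \<le> a p"
    and det: "\<And>p. p \<in> \<Omega> \<Longrightarrow> m * a p \<le> a p * c p - (b p)\<^sup>2"
  obtains R d where "0 < R" "0 < d"
    "\<And>p0. \<forall>p\<in>rel_ball_pos \<Omega> b R p0. \<forall>q\<in>rel_ball_pos \<Omega> b R p0. b p / a p + d \<le> c q / b q"
    "\<And>p0. \<forall>p\<in>rel_ball_neg \<Omega> b R p0. \<forall>q\<in>rel_ball_neg \<Omega> b R p0. c p / b p + d \<le> b q / a q"
proof -
  have compact: "compact (closure \<Omega>)" using assms(1) by simp
  have sub: "\<And>p. p \<in> \<Omega> \<Longrightarrow> p \<in> closure \<Omega>" using closure_subset by blast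
  obtain M where "0 < M" and M: "\<And>p. p \<in> closure \<Omega> \<Longrightarrow> \<bar>b p\<bar> \<le> M"
    using compact_imp_bounded[OF compact_continuous_image[OF cont(2) compact]]
    unfolding bounded_pos by (metis imageI real_norm_def)
  have "m / (2 * M) > 0" using \<open>0 < m\<close> \<open>0 < M\<close> by simp
  have "a p \<noteq> 0" if "p \<in> closure \<Omega>" for p using m that by fastforce
  then have "continuous_on (closure \<Omega>) (\<lambda>p. b p / a p)"
    by (intro continuous_on_divide cont) auto
  then have "uniformly_continuous_on (closure \<Omega>) (\<lambda>p. b p / a p)"
    using compact by (rule compact_uniformly_continuous)
  then obtain r where "0 < r" and
    r: "\<And>p q. p \<in> closure \<Omega> \<Longrightarrow> q \<in> closure \<Omega> \<Longrightarrow> dist q p < r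
      \<Longrightarrow> \<bar>b q / a q - b p / a p\<bar> < m / (2 * M)"
    using \<open>m / (2 * M) > 0\<close> unfolding uniformly_continuous_on_def dist_real_def by metis
  have osc: "\<bar>b q / a q - b p / a p\<bar> < m / (2 * M)"
    if "p \<in> rel_ball \<Omega> (r / 2) p0" "q \<in> rel_ball \<Omega> (r / 2) p0" for p q p0
  proof -
    have "p \<in> \<Omega>" "q \<in> \<Omega>" "dist q p0 < r / 2" "dist p p0 < r / 2"
      using that by (auto simp: rel_ball_def dist_norm)
    with dist_triangle_half_l[of q p0 r p] show ?thesis by (intro r sub) auto
  qed
  have half: "m / M = m / (2 * M) + m / (2 * M)" using \<open>0 < M\<close> by (simp add: field_simps)
  show ?thesis
  proof (rule that)
    show "0 < r / 2" using \<open>0 < r\<close> by simp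
    show "0 < m / (2 * M)" by fact
    show "\<forall>p\<in>rel_ball_pos \<Omega> b (r / 2) p0. \<forall>q\<in>rel_ball_pos \<Omega> b (r / 2) p0.
        b p / a p + m / (2 * M) \<le> c q / b q" for p0
    proof (intro ballI)
      fix p q
      assume that: "p \<in> rel_ball_pos \<Omega> b (r / 2) p0" "q \<in> rel_ball_pos \<Omega> b (r / 2) p0"
      have "q \<in> \<Omega>" "0 < b q" "p \<in> rel_ball \<Omega> (r / 2) p0" "q \<in> rel_ball \<Omega> (r / 2) p0"
        using that by (auto simp: rel_ball_pos_def rel_ball_def)
      moreover from this have "b q / a q + m / M \<le> c q / b q"
        using M[of q] m(2)[of q] sub[of q] by (intro slope_gap_pos det \<open>0 < m\<close>) auto
      ultimately show "b p / a p + m / (2 * M) \<le> c q / b q" using osc[of p p0 q] half by linarith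
    qed
    show "\<forall>p\<in>rel_ball_neg \<Omega> b (r / 2) p0. \<forall>q\<in>rel_ball_neg \<Omega> b (r / 2) p0.
        c p / b p + m / (2 * M) \<le> b q / a q" for p0
    proof (intro ballI)
      fix p q
      assume that: "p \<in> rel_ball_neg \<Omega> b (r / 2) p0" "q \<in> rel_ball_neg \<Omega> b (r / 2) p0"
      have "p \<in> \<Omega>" "b p < 0" "p \<in> rel_ball \<Omega> (r / 2) p0" "q \<in> rel_ball \<Omega> (r / 2) p0"
        using that by (auto simp: rel_ball_neg_def rel_ball_def)
      moreover from this have "c p / b p + m / M \<le> b p / a p"
        using M[of p] m(2)[of p] sub[of p] by (intro slope_gap_neg det \<open>0 < m\<close>) auto
      ultimately show "c p / b p + m / (2 * M) \<le> b q / a q" using osc[of p p0 q] half by linarith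
    qed
  qed
qed

theorem theorem2p1:
  fixes \<Omega> :: "(real^2) set"
    and D :: "real^2 \<Rightarrow> real^2^2"
    and a b c :: "real^2 \<Rightarrow> real"
  assumes "open \<Omega>" and "connected \<Omega>" and "\<Omega> \<noteq> {}" and "bounded \<Omega>"
    and "\<And>p. p \<in> closure \<Omega> \<Longrightarrow> D p = vector [vector [a p, b p], vector [b p, c p]]"
    and "continuous_on (closure \<Omega>) D"
    and "\<And>p. p \<in> \<Omega> \<Longrightarrow> transpose (D p) = D p"
    and "uniformly_positive_definite_on \<Omega> D"
  shows "\<exists>R>0. \<forall>p0\<in>\<Omega>.
    (rel_ball_pos \<Omega> b R p0 \<noteq> {} \<longrightarrow> slopes_pos a b c (rel_ball_pos \<Omega> b R p0) \<noteq> {}) \<and>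
    (rel_ball_neg \<Omega> b R p0 \<noteq> {} \<longrightarrow> slopes_neg a b c (rel_ball_neg \<Omega> b R p0) \<noteq> {}) \<and>
    (\<forall>\<beta>1 \<beta>2.
      sin \<beta>1 * cos \<beta>1 \<noteq> 0 \<and> sin \<beta>2 * cos \<beta>2 \<noteq> 0 \<and>
      (rel_ball_pos \<Omega> b R p0 \<noteq> {} \<longrightarrow> tan \<beta>1 \<in> slopes_pos a b c (rel_ball_pos \<Omega> b R p0)) \<and>
      (rel_ball_neg \<Omega> b R p0 \<noteq> {} \<longrightarrow> tan \<beta>2 \<in> slopes_neg a b c (rel_ball_neg \<Omega> b R p0))
      \<longrightarrow>
      (\<forall>p\<in>rel_ball \<Omega> R p0.
         gamma0 a b \<beta>1 \<beta>2 p \<ge> 0 \<and> gamma1_pos b \<beta>1 p \<ge> 0 \<and>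
         gamma1_neg b \<beta>2 p \<ge> 0 \<and> gamma2 b c \<beta>1 \<beta>2 p \<ge> 0) \<and>
      (\<forall>u. C1_near u p0 \<and>
           (\<lambda>p. gamma0 a b \<beta>1 \<beta>2 p * partial_x u p) differentiable (at p0) \<and>
           (\<lambda>p. gamma1_pos b \<beta>1 p * partial_angle \<beta>1 u p) differentiable (at p0) \<and>
           (\<lambda>p. gamma1_neg b \<beta>2 p * partial_angle \<beta>2 u p) differentiable (at p0) \<and>
           (\<lambda>p. gamma2 b c \<beta>1 \<beta>2 p * partial_y u p) differentiable (at p0)
           \<longrightarrow>
           (\<lambda>p. D p *v gradient u p) differentiable (at p0) \<and>
           divergence (\<lambda>p. D p *v gradient u p) p0 =
             partial_x (\<lambda>p. gamma0 a b \<beta>1 \<beta>2 p * partial_x u p) p0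
             + partial_angle \<beta>1 (\<lambda>p. gamma1_pos b \<beta>1 p * partial_angle \<beta>1 u p) p0
             + partial_angle \<beta>2 (\<lambda>p. gamma1_neg b \<beta>2 p * partial_angle \<beta>2 u p) p0
             + partial_y (\<lambda>p. gamma2 b c \<beta>1 \<beta>2 p * partial_y u p) p0))"
proof -
  have sub: "\<And>p. p \<in> \<Omega> \<Longrightarrow> p \<in> closure \<Omega>" using closure_subset by blast
  have entries: "a p = D p $ 1 $ 1" "b p = D p $ 1 $ 2" if "p \<in> closure \<Omega>" for p
    using assms(5)[OF that] by simp_all
  have cont: "continuous_on (closure \<Omega>) a" "continuous_on (closure \<Omega>) b"
    using continuous_on_component[OF continuous_on_component[OF assms(6)]]
    by (simp_all add: entries cong: continuous_on_cong)
  obtain m where "0 < m" and pd: "\<And>p \<xi>. p \<in> \<Omega> \<Longrightarrow> m * (norm \<xi>)\<^sup>2 \<le> \<xi> \<bullet> (D p *v \<xi>)"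
    using assms(8) unfolding uniformly_positive_definite_on_def by blast
  have bounds: "m \<le> a p" "m \<le> c p" "m * a p \<le> a p * c p - (b p)\<^sup>2" if "p \<in> \<Omega>" for p
    using pd[OF that, unfolded assms(5)[OF sub[OF that]]] \<open>0 < m\<close>
    by (rule positive_definite_entry_bounds)+
  have a_ge: "m \<le> a p" if "p \<in> closure \<Omega>" for p
    using continuous_ge_on_closure[OF cont(1) that] bounds(1) by blast
  obtain R d where "0 < R" "0 < d" and gap_pos:
    "\<And>p0. \<forall>p\<in>rel_ball_pos \<Omega> b R p0. \<forall>q\<in>rel_ball_pos \<Omega> b R p0. b p / a p + d \<le> c q / b q" and gap_neg:
    "\<And>p0. \<forall>p\<in>rel_ball_neg \<Omega> b R p0. \<forall>q\<in>rel_ball_neg \<Omega> b R p0. c p / b p + d \<le> b q / a q"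
    using uniform_slope_gap[OF assms(4) cont \<open>0 < m\<close> a_ge bounds(3)] by metis
  show ?thesis
  proof (intro exI[of _ R] conjI ballI impI allI \<open>0 < R\<close>; (elim conjE)?)
    fix p0
    assume "rel_ball_pos \<Omega> b R p0 \<noteq> {}"
    from SUP_less_INF_if_gap[OF this \<open>0 < d\<close> gap_pos]
    show "slopes_pos a b c (rel_ball_pos \<Omega> b R p0) \<noteq> {}" by (simp add: slopes_pos_def)
  next
    fix p0
    assume "rel_ball_neg \<Omega> b R p0 \<noteq> {}"
    from SUP_less_INF_if_gap[OF this \<open>0 < d\<close> gap_neg]
    show "slopes_neg a b c (rel_ball_neg \<Omega> b R p0) \<noteq> {}" by (simp add: slopes_neg_def)
  next
    fix p0 \<beta>1 \<beta>2 p
    assume t1: "rel_ball_pos \<Omega> b R p0 \<noteq> {} \<longrightarrow> tan \<beta>1 \<in> slopes_pos a b c (rel_ball_pos \<Omega> b R p0)"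
      and t2: "rel_ball_neg \<Omega> b R p0 \<noteq> {} \<longrightarrow> tan \<beta>2 \<in> slopes_neg a b c (rel_ball_neg \<Omega> b R p0)"
      and p: "p \<in> rel_ball \<Omega> R p0"
    have "p \<in> \<Omega>" using p by (simp add: rel_ball_def)
    then have ac: "0 < a p" "0 \<le> c p" using bounds[of p] \<open>0 < m\<close> by auto
    have pos: "b p / a p < tan \<beta>1 \<and> tan \<beta>1 < c p / b p" if "0 < b p"
    proof -
      have mem: "p \<in> rel_ball_pos \<Omega> b R p0" using p that by (simp add: rel_ball_pos_def)
      with t1 have "tan \<beta>1 \<in> slopes_pos a b c (rel_ball_pos \<Omega> b R p0)" by blast
      from between_SUP_INF_if_gap[OF mem \<open>0 < d\<close> gap_pos this[unfolded slopes_pos_def]]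
      show ?thesis by simp
    qed
    have neg: "c p / b p < tan \<beta>2 \<and> tan \<beta>2 < b p / a p" if "b p < 0"
    proof -
      have mem: "p \<in> rel_ball_neg \<Omega> b R p0" using p that by (simp add: rel_ball_neg_def)
      with t2 have "tan \<beta>2 \<in> slopes_neg a b c (rel_ball_neg \<Omega> b R p0)" by blast
      from between_SUP_INF_if_gap[OF mem \<open>0 < d\<close> gap_neg this[unfolded slopes_neg_def]]
      show ?thesis by simp
    qed
    note nonneg = gammas_nonneg[of a p c b \<beta>1 \<beta>2, OF ac pos neg]
    show "0 \<le> gamma0 a b \<beta>1 \<beta>2 p" by (rule nonneg(1))
    show "0 \<le> gamma1_pos b \<beta>1 p" by (rule nonneg(2))
    show "0 \<le> gamma1_neg b \<beta>2 p" by (rule nonneg(3))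
    show "0 \<le> gamma2 b c \<beta>1 \<beta>2 p" by (rule nonneg(4))
  next
    fix p0 \<beta>1 \<beta>2 u
    assume "p0 \<in> \<Omega>" and angles: "sin \<beta>1 * cos \<beta>1 \<noteq> 0" "sin \<beta>2 * cos \<beta>2 \<noteq> 0"
      and u: "C1_near u p0"
      and diff: "(\<lambda>p. gamma0 a b \<beta>1 \<beta>2 p * partial_x u p) differentiable (at p0)"
        "(\<lambda>p. gamma1_pos b \<beta>1 p * partial_angle \<beta>1 u p) differentiable (at p0)"
        "(\<lambda>p. gamma1_neg b \<beta>2 p * partial_angle \<beta>2 u p) differentiable (at p0)"
        "(\<lambda>p. gamma2 b c \<beta>1 \<beta>2 p * partial_y u p) differentiable (at p0)"
    have u_near: "\<forall>\<^sub>F p in nhds p0. u differentiable (at p)"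
      using u unfolding C1_near_def eventually_nhds by (metis differentiableI)
    have D_near: "\<forall>\<^sub>F p in nhds p0. D p = vector [vector [a p, b p], vector [b p, c p]]"
      using eventually_nhds_in_open[OF assms(1) \<open>p0 \<in> \<Omega>\<close>] by (rule eventually_mono) (intro assms(5) sub)
    note split = divergence_splitting[OF angles u_near D_near diff]
    show "(\<lambda>p. D p *v gradient u p) differentiable (at p0)" by (rule split(1))
    show "divergence (\<lambda>p. D p *v gradient u p) p0 =
             partial_x (\<lambda>p. gamma0 a b \<beta>1 \<beta>2 p * partial_x u p) p0
             + partial_angle \<beta>1 (\<lambda>p. gamma1_pos b \<beta>1 p * partial_angle \<beta>1 u p) p0
             + partial_angle \<beta>2 (\<lambda>p. gamma1_neg b \<beta>2 p * partial_angle \<beta>2 u p) p0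
             + partial_y (\<lambda>p. gamma2 b c \<beta>1 \<beta>2 p * partial_y u p) p0"
      by (rule split(2))
  qed
qed

end
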